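(* The sharp $\mathscr{S}^*_{\wp,n}$-radius of the class $\mathcal{F}_n$ is $R_{\mathscr{S}^*_{\wp,n}}(\mathcal{F}_n)=\left(\sqrt{1+n^2e^2}-ne\right)^{1/n}$. In particular ($n=1$), the $\mathscr{S}^*_\wp$-radius of $\mathcal{F}=\{f\in\mathcal{A}:\operatorname{Re}(f(z)/z)>0\}$ is $\sqrt{1+e^2}-e$.
   Context: $\mathbb{D}$ is the unit disk. For $n\ge1$, $\mathcal{A}_n$ is the class of analytic $f$ on $\mathbb{D}$ of the form $f(z)=z+\sum_{k\ge n+1}b_kz^k$, $\mathcal{A}=\mathcal{A}_1$. $f\prec g$ means $f=g\circ\omega$ for analytic $\omega:\mathbb{D}\to\mathbb{D}$, $\omega(0)=0$. $\wp(z)=1+ze^z$, $\mathscr{S}^*_\wp=\{f\in\mathcal{A}:zf'/f\prec\wp\}$, $\mathscr{S}^*_{\wp,n}=\mathcal{A}_n\cap\mathscr{S}^*_\wp$. $\mathcal{P}_n$ is the class of analytic $p(z)=1+\sum_{k\ge n}c_kz^k$ with $\operatorname{Re}p>0$ on $\mathbb{D}$, and $\mathcal{F}_n=\{f\in\mathcal{A}_n: f(z)/z\in\mathcal{P}_n\}$. For classes $G_1,G_2$, the $G_1$-radius $R_{G_1}(G_2)$ is the largest $r_0\in(0,1]$ such that $r^{-1}f(rz)\in G_1$ for all $0<r\le r_0$ and all $f\in G_2$; "sharp" means this number cannot be increased (some $f\in G_2$ fails beyond it). *)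

theory Defs
  imports "HOL-Analysis.Analysis"
begin

definition unit_disk :: "complex set" where
  "unit_disk = ball 0 1"

definition class_A :: "nat \<Rightarrow> (complex \<Rightarrow> complex) set" where
  "class_A n = {f. f holomorphic_on unit_disk \<and>
     (\<exists>b::nat \<Rightarrow> complex. b 0 = 0 \<and> b 1 = 1 \<and> (\<forall>k. 2 \<le> k \<and> k \<le> n \<longrightarrow> b k = 0) \<and>
        (\<forall>z\<in>unit_disk. (\<lambda>k. b k * z ^ k) sums f z))}"

definition subordinate :: "(complex \<Rightarrow> complex) \<Rightarrow> (complex \<Rightarrow> complex) \<Rightarrow> bool" where
  "subordinate f g \<longleftrightarrow> (\<exists>\<omega>. \<omega> holomorphic_on unit_disk \<and> \<omega> ` unit_disk \<subseteq> unit_disk \<and>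
      \<omega> 0 = 0 \<and> (\<forall>z\<in>unit_disk. f z = g (\<omega> z)))"

definition wp :: "complex \<Rightarrow> complex" where
  "wp z = 1 + z * exp z"

text \<open>z f'(z)/f(z), with its removable value 1 at the origin (f(0)=0, f'(0)=1).\<close>
definition zf'_over_f :: "(complex \<Rightarrow> complex) \<Rightarrow> complex \<Rightarrow> complex" where
  "zf'_over_f f z = (if z = 0 then 1 else z * deriv f z / f z)"

definition S_wp :: "(complex \<Rightarrow> complex) set" where
  "S_wp = {f \<in> class_A 1. subordinate (zf'_over_f f) wp}"

definition S_wp_n :: "nat \<Rightarrow> (complex \<Rightarrow> complex) set" where
  "S_wp_n n = class_A n \<inter> S_wp"

definition class_P :: "nat \<Rightarrow> (complex \<Rightarrow> complex) set" where
  "class_P n = {p. p holomorphic_on unit_disk \<and>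
     (\<exists>c::nat \<Rightarrow> complex. c 0 = 1 \<and> (\<forall>k. 1 \<le> k \<and> k < n \<longrightarrow> c k = 0) \<and>
        (\<forall>z\<in>unit_disk. (\<lambda>k. c k * z ^ k) sums p z)) \<and>
     (\<forall>z\<in>unit_disk. Re (p z) > 0)}"

text \<open>F_n = {f in A_n : f(z)/z in P_n} (value 1 at the origin, the removable value).\<close>
definition class_F :: "nat \<Rightarrow> (complex \<Rightarrow> complex) set" where
  "class_F n = {f \<in> class_A n. (\<lambda>z. if z = 0 then 1 else f z / z) \<in> class_P n}"

definition radius_good :: "(complex \<Rightarrow> complex) set \<Rightarrow> (complex \<Rightarrow> complex) set \<Rightarrow> real \<Rightarrow> bool" where
  "radius_good G1 G2 r0 \<longleftrightarrow>
     (\<forall>r. 0 < r \<and> r \<le> r0 \<longrightarrow> (\<forall>f\<in>G2. (\<lambda>z. f (of_real r * z) / of_real r) \<in> G1))"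

definition is_radius :: "(complex \<Rightarrow> complex) set \<Rightarrow> (complex \<Rightarrow> complex) set \<Rightarrow> real \<Rightarrow> bool" where
  "is_radius G1 G2 R \<longleftrightarrow> R \<in> {0<..1} \<and> radius_good G1 G2 R \<and>
     (\<forall>r0\<in>{0<..1}. radius_good G1 G2 r0 \<longrightarrow> r0 \<le> R)"

end

theory Submission
  imports Defs "HOL-Complex_Analysis.Complex_Analysis"
begin

text \<open>
  For \<open>f(z) = z p(z)\<close> with \<open>p\<close> in \<open>P\<^sub>n\<close> one has \<open>z f'/f = 1 + z p'/p\<close>, and the Schwarz--Pick
  inequality for \<open>(1 - p)/(1 + p) = z^n \<psi>\<close> gives \<open>|z p'/p| \<le> 2 n t/(1 - t\<^sup>2)\<close> with \<open>t = |z|^n\<close>.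
  This is below \<open>1/e\<close> exactly when \<open>t\<^sup>2 + 2 n e t < 1\<close>, i.e. when \<open>|z|\<close> is below the claimed radius.
  The disk of radius \<open>1/e\<close> about the origin is the image under \<open>z e^z\<close> of a part of the unit disk on
  which a holomorphic inverse (Lambert's W) exists: \<open>z \<mapsto> w e^(-z)\<close> is a contraction of the
  closed unit disk when \<open>|w| < 1/e\<close>. Composing with this inverse yields the subordination.
  For \<open>p = (1 - z^n)/(1 + z^n)\<close> the value \<open>z p'/p = -1/e\<close> is attained at the claimed radius, but
  \<open>z e^z\<close> takes the value \<open>-1/e\<close> nowhere in the open unit disk.
\<close>

section \<open>Exponential estimates and the inverse of \<open>z * exp z\<close>\<close>

lemma norm_exp_diff_le:
  fixes a b :: complex
  assumes "Re a \<le> K" "Re b \<le> K"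
  shows "norm (exp a - exp b) \<le> exp K * norm (a - b)"
proof (rule field_differentiable_bound[of "{z. Re z \<le> K}" exp exp])
  show "convex {z. Re z \<le> K}" by (rule convex_halfspace_Re_le)
qed (use assms in \<open>auto intro!: derivative_eq_intros\<close>)

lemma norm_exp_diff_less:
  fixes a b :: complex
  assumes "Re a < K" "Re b \<le> K" "a \<noteq> b"
  shows "norm (exp a - exp b) < exp K * norm (a - b)"
proof -
  \<comment> \<open>On the half of the segment adjacent to \<open>a\<close> the derivative stays strictly below \<open>exp K\<close>.\<close>
  define m where "m = (a + b) / 2"
  define L where "L = max (Re a) (Re m)"
  have L: "L < K" using assms by (auto simp: L_def m_def)
  have am: "norm (a - m) = norm (a - b) / 2" "norm (m - b) = norm (a - b) / 2"
    by (simp_all add: m_def field_simps flip: norm_divide_numeral)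
  have "norm (exp a - exp b) \<le> norm (exp a - exp m) + norm (exp m - exp b)"
    using norm_triangle_ineq[of "exp a - exp m" "exp m - exp b"] by simp
  also have "norm (exp a - exp m) \<le> exp L * norm (a - m)"
    by (rule norm_exp_diff_le) (auto simp: L_def)
  also have "norm (exp m - exp b) \<le> exp K * norm (m - b)"
    by (rule norm_exp_diff_le) (use assms in \<open>auto simp: m_def\<close>)
  also have "exp L * norm (a - m) < exp K * norm (a - m)"
    using L assms(3) by (intro mult_strict_right_mono) (auto simp: am)
  finally show ?thesis by (simp add: am)
qed

text \<open>Points with the same value \<open>w\<close> are both fixed by
  \<open>z \<mapsto> w * exp (- z)\<close>. In the open unit disk this map strictly shrinks
  distances as long as \<open>norm w \<le> 1 / exp 1\<close>, because the estimate for
  \<open>exp\<close> is strict; hence the two points coincide.\<close>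

lemma inj_on_mult_exp_small:
  "inj_on (\<lambda>z::complex. z * exp z) {z. norm z < 1 \<and> norm (z * exp z) \<le> 1 / exp 1}"
proof (rule inj_onI, rule ccontr)
  fix a b :: complex
  assume a: "a \<in> {z. norm z < 1 \<and> norm (z * exp z) \<le> 1 / exp 1}"
    and b: "b \<in> {z. norm z < 1 \<and> norm (z * exp z) \<le> 1 / exp 1}"
    and eq: "a * exp a = b * exp b" and "a \<noteq> b"
  define w where "w = a * exp a"
  have ab: "a = w * exp (- a)" "b = w * exp (- b)"
    by (simp add: w_def exp_minus) (simp add: w_def eq exp_minus)
  have "a - b = w * (exp (- a) - exp (- b))"
    using ab by (simp add: right_diff_distrib)
  then have "norm (a - b) = norm w * norm (exp (- a) - exp (- b))"
    by (metis norm_mult)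
  also have "\<dots> \<le> 1 / exp 1 * norm (exp (- a) - exp (- b))"
    using a by (intro mult_right_mono) (auto simp: w_def)
  also have "norm (exp (- a) - exp (- b)) < exp 1 * norm (- a - - b)"
    using a b \<open>a \<noteq> b\<close> abs_Re_le_cmod[of a] abs_Re_le_cmod[of b]
    by (intro norm_exp_diff_less) auto
  finally show False
    by (simp add: norm_minus_commute divide_strict_right_mono)
qed

lemma mult_exp_surj_small:
  fixes w :: complex
  assumes "norm w < 1 / exp 1"
  obtains z where "norm z < 1" "z * exp z = w"
proof -
  have c: "norm w * exp 1 < 1" using assms by (simp add: field_simps)
  have ex: "norm (exp (- z)) \<le> exp 1" if "norm z \<le> 1" for z :: complex
    using that abs_Re_le_cmod[of z] by simp
  \<comment> \<open>The closed disk is mapped into the open one: the weak form gives the self-map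
    for Banach's theorem, the strict form puts the fixed point inside the open disk.\<close>
  have bd: "norm (w * exp (- z)) < 1" if "norm z \<le> 1" for z
    using mult_left_mono[OF ex[OF that] norm_ge_zero[of w]] c by (simp only: norm_mult)
  have "\<exists>!z\<in>cball 0 1. w * exp (- z) = z"
  proof (rule Banach_fix[where c = "norm w * exp 1"])
    show "complete (cball (0::complex) 1)" by (simp add: complete_eq_closed)
    show "(\<lambda>z. w * exp (- z)) ` cball 0 1 \<subseteq> cball 0 1"
      using bd by (force simp: less_imp_le)
    fix x y :: complex assume "x \<in> cball 0 1" "y \<in> cball 0 1"
    then have xy: "norm x \<le> 1" "norm y \<le> 1" by auto
    have "norm (exp (- x) - exp (- y)) \<le> exp 1 * norm (- x - - y)"
      using xy abs_Re_le_cmod[of x] abs_Re_le_cmod[of y] by (intro norm_exp_diff_le) auto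
    then have "norm w * norm (exp (- x) - exp (- y)) \<le> norm w * (exp 1 * norm (- x - - y))"
      by (intro mult_left_mono) auto
    then show "dist (w * exp (- x)) (w * exp (- y)) \<le> norm w * exp 1 * dist x y"
      by (simp add: dist_norm norm_minus_commute mult.assoc flip: right_diff_distrib norm_mult)
  qed (use c in auto)
  then obtain z where z: "norm z \<le> 1" "w * exp (- z) = z" by auto
  have "norm z < 1" using bd[OF z(1)] z(2) by simp
  moreover have "z * exp z = w" using z(2) by (metis exp_minus_inverse mult.assoc mult.commute mult.right_neutral)
  ultimately show ?thesis using that by blast
qed

lemma Lambert_W_exists:
  obtains W :: "complex \<Rightarrow> complex" where
    "W holomorphic_on ball 0 (1 / exp 1)" "W ` ball 0 (1 / exp 1) \<subseteq> ball 0 1"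
    "\<And>w. w \<in> ball 0 (1 / exp 1) \<Longrightarrow> W w * exp (W w) = w" "W 0 = 0"
proof -
  \<comment> \<open>\<open>S\<close> is the preimage of the ball of radius 1/e inside the unit disk.
    It is open, \<open>z * exp z\<close> is injective on it, and surjectivity makes its image cover
    the ball, so the inverse of an injective holomorphic map is defined on the whole ball.\<close>
  define S where "S = {z::complex. norm z < 1 \<and> norm (z * exp z) < 1 / exp 1}"
  have op: "open S" unfolding S_def
    by (intro open_Collect_conj open_Collect_less continuous_intros)
  have hol: "(\<lambda>z. z * exp z) holomorphic_on S" by (intro holomorphic_intros)
  have inj: "inj_on (\<lambda>z. z * exp z) S"
    by (rule inj_on_subset[OF inj_on_mult_exp_small]) (auto simp: S_def)
  obtain W where W: "W holomorphic_on (\<lambda>z. z * exp z) ` S"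
    "\<And>z. z \<in> S \<Longrightarrow> deriv (\<lambda>z. z * exp z) z * deriv W (z * exp z) = 1"
    "\<And>z. z \<in> S \<Longrightarrow> W (z * exp z) = z"
    by (rule holomorphic_has_inverse[OF hol op inj]) (rule that)
  have img: "\<exists>z\<in>S. w = z * exp z" if w: "w \<in> ball 0 (1 / exp 1)" for w
  proof -
    obtain z where "norm z < 1" "z * exp z = w"
      by (rule mult_exp_surj_small[of w]) (use w in auto)
    then show ?thesis using w by (intro bexI[of _ z]) (auto simp: S_def)
  qed
  show ?thesis
  proof
    show "W holomorphic_on ball 0 (1 / exp 1)"
      by (rule holomorphic_on_subset[OF W(1)]) (use img in blast)
    show "W ` ball 0 (1 / exp 1) \<subseteq> ball 0 1"
      using img W(3) by (fastforce simp: S_def)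
    show "W w * exp (W w) = w" if "w \<in> ball 0 (1 / exp 1)" for w
      using img[OF that] W(3) by fastforce
    show "W 0 = 0" using W(3)[of 0] by (simp add: S_def)
  qed
qed

text \<open>The value -1/e is taken at the boundary point -1, which solves the same fixed-point
  equation \<open>z = - (1 / exp 1) * exp (- z)\<close>. Subtracting the two equations and using the
  strict estimate for \<open>exp\<close>, a solution in the open disk would satisfy |z + 1| < |z +
  1|.\<close>

lemma mult_exp_neq_neg_inverse_exp:
  fixes z :: complex
  assumes "norm z < 1"
  shows "z * exp z \<noteq> - (1 / exp 1)"
proof
  assume "z * exp z = - (1 / exp 1)"
  then have z: "z = - (1 / exp 1) * exp (- z)"
    by (metis exp_minus_inverse mult.assoc mult.right_neutral)
  have "norm (z - - 1) = norm (exp (- z) - exp 1) / exp 1"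
  proof -
    have "z - - 1 = - (exp (- z) - exp 1) / exp 1" by (subst z) (simp add: field_simps)
    then show ?thesis by (simp add: norm_divide norm_minus_commute)
  qed
  also have "\<dots> < norm (- z - 1)"
  proof -
    have "norm (exp (- z) - exp 1) < exp 1 * norm (- z - 1)"
      using assms abs_Re_le_cmod[of z] norm_minus_cancel[of z]
      by (intro norm_exp_diff_less) (auto simp del: norm_minus_cancel)
    then show ?thesis by (simp add: field_simps)
  qed
  also have "\<dots> = norm (z - - 1)" by (metis minus_add_distrib norm_minus_cancel uminus_add_conv_diff diff_minus_eq_add add.commute)
  finally show False by simp
qed

section \<open>Schwarz-Pick inequalities, including a zero of order n at the origin\<close>

lemma Schwarz_Pick_deriv_strict:
  assumes holg: "g holomorphic_on ball 0 1"
    and no: "\<And>z. norm z < 1 \<Longrightarrow> norm (g z) < 1" and a: "norm a < 1"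
  shows "(1 - (norm a)\<^sup>2) * norm (deriv g a) \<le> 1 - (norm (g a))\<^sup>2"
proof -
  define M where "M = Moebius_function 0"
  \<comment> \<open>\<open>M (- a)\<close> sends 0 to \<open>a\<close> and \<open>M (g a)\<close>
    sends \<open>g a\<close> to 0, so \<open>F\<close> fixes 0 and the Schwarz lemma bounds its
    derivative there.\<close>
  define F where "F = M (g a) \<circ> g \<circ> M (- a)"
  have b: "norm (g a) < 1" using no a by blast
  have dM: "(M w has_field_derivative (1 - cnj w * w) / (1 - cnj w * z)\<^sup>2) (at z)"
    if "1 - cnj w * z \<noteq> 0" for w z
    unfolding M_def Moebius_function_def using that
    by (auto intro!: derivative_eq_intros simp: field_simps power2_eq_square)
  have nz: "1 - cnj w * w \<noteq> 0" if "norm w < 1" for w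
  proof
    assume "1 - cnj w * w = 0"
    then have "norm (cnj w * w) = 1" by simp
    then show False using that mult_strict_mono[OF that that] by (simp add: norm_mult)
  qed
  have M0: "M (- a) 0 = a" by (simp add: M_def Moebius_function_of_zero)
  have Mb: "norm (M w z) < 1" if "norm w < 1" "norm z < 1" for w z
    unfolding M_def by (rule Moebius_function_norm_lt_1[OF that])
  have holM: "M w holomorphic_on ball 0 1" if "norm w < 1" for w
    unfolding M_def by (rule Moebius_function_holomorphic[OF that])
  have "F holomorphic_on ball 0 1"
    unfolding F_def o_assoc[symmetric] using a b Mb no
    by (intro holomorphic_on_compose_gen[where t = "ball 0 1"] holM holg) auto
  moreover have "F 0 = 0" by (simp add: F_def M0) (simp add: M_def Moebius_function_eq_zero)
  moreover have "norm (F z) < 1" if "norm z < 1" for z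
    using that a b Mb no by (simp add: F_def)
  ultimately have le: "norm (deriv F 0) \<le> 1"
    by (rule Schwarz_Lemma(2)[where \<xi> = 0]) auto
  have dg: "(g has_field_derivative deriv g a) (at (M (- a) 0))"
    using holomorphic_derivI[OF holg] a by (simp add: M0)
  \<comment> \<open>The first quotient is the derivative of \<open>M (g a)\<close> at its zero
    \<open>g a\<close>; the factor \<open>1 - cnj a * a\<close> is that of \<open>M (- a)\<close> at
    0.\<close>
  have "(F has_field_derivative
      (1 - cnj (g a) * g a) / (1 - cnj (g a) * g a)\<^sup>2 * (deriv g a * (1 - cnj a * a))) (at 0)"
    unfolding F_def o_assoc[symmetric] 
    using dM[of "- a" 0] dM[of "g a" "g a"] nz[OF b]
    by (intro DERIV_chain dg) (simp_all add: M0)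
  then have "deriv F 0 = deriv g a * (1 - cnj a * a) / (1 - cnj (g a) * g a)"
    using nz[OF b] by (simp add: DERIV_imp_deriv power2_eq_square)
  moreover have "1 - cnj w * w = of_real (1 - (norm w)\<^sup>2)" for w
    by (simp add: complex_norm_square mult.commute flip: of_real_power)
  ultimately have "norm (deriv F 0) = norm (deriv g a) * \<bar>1 - (norm a)\<^sup>2\<bar> / \<bar>1 - (norm (g a))\<^sup>2\<bar>"
    by (simp only: norm_mult norm_divide norm_of_real)
  moreover have "(norm a)\<^sup>2 < 1" "(norm (g a))\<^sup>2 < 1" using a b by (simp_all add: power_less_one_iff)
  ultimately show ?thesis using le by (simp add: mult.commute)
qed

lemma Schwarz_Pick_deriv:
  assumes holg: "g holomorphic_on ball 0 1"
    and no: "\<And>z. norm z < 1 \<Longrightarrow> norm (g z) \<le> 1" and a: "norm a < 1"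
  shows "(1 - (norm a)\<^sup>2) * norm (deriv g a) \<le> 1 - (norm (g a))\<^sup>2"
proof -
  \<comment> \<open>Scaling by \<open>k < 1\<close> avoids the separate case of a constant of modulus 1.\<close>
  have "(1 - (norm a)\<^sup>2) * (k * norm (deriv g a)) \<le> 1 - (k * norm (g a))\<^sup>2" if k: "0 < k" "k < 1" for k
  proof -
    have "norm (of_real k * g z) < 1" if "norm z < 1" for z
    proof -
      have "norm (of_real k * g z) \<le> k * 1"
        using k no[OF that] by (simp add: norm_mult)
      then show ?thesis using k by simp
    qed
    moreover have "(\<lambda>z. of_real k * g z) holomorphic_on ball 0 1"
      by (intro holomorphic_intros holg)
    ultimately have "(1 - (norm a)\<^sup>2) * norm (deriv (\<lambda>z. of_real k * g z) a) \<le> 1 - (norm (of_real k * g a))\<^sup>2"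
      using a by (intro Schwarz_Pick_deriv_strict) auto
    moreover have "deriv (\<lambda>z. of_real k * g z) a = of_real k * deriv g a"
      using holg a by (intro deriv_cmult) (auto simp: holomorphic_on_imp_differentiable_at)
    ultimately show ?thesis using k by (simp add: norm_mult)
  qed
  then have "eventually (\<lambda>k. (1 - (norm a)\<^sup>2) * (k * norm (deriv g a)) \<le> 1 - (k * norm (g a))\<^sup>2) (at_left 1)"
    unfolding eventually_at_left_field by (intro exI[of _ 0]) auto
  moreover have "((\<lambda>k. (1 - (norm a)\<^sup>2) * (k * norm (deriv g a))) \<longlongrightarrow>
      (1 - (norm a)\<^sup>2) * (1 * norm (deriv g a))) (at_left 1)"
    by (intro tendsto_intros)
  moreover have "((\<lambda>k. 1 - (k * norm (g a))\<^sup>2) \<longlongrightarrow> 1 - (1 * norm (g a))\<^sup>2) (at_left 1)"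
    by (intro tendsto_intros)
  ultimately show ?thesis
    using tendsto_le[of "at_left (1::real)"] by fastforce
qed

text \<open>On the circle of radius \<open>t\<close> the hypothesis gives the bound
  \<open>1 / t ^ n\<close>. The maximum modulus principle carries it to \<open>a\<close>, and
  \<open>t\<close> tends to 1.\<close>

lemma norm_le_1_of_power_mult:
  fixes \<psi> :: "complex \<Rightarrow> complex"
  assumes hol: "\<psi> holomorphic_on ball 0 1"
    and no: "\<And>z. norm z < 1 \<Longrightarrow> norm (z ^ n * \<psi> z) \<le> 1" and a: "norm a < 1"
  shows "norm (\<psi> a) \<le> 1"
proof -
  have le: "norm (\<psi> a) \<le> 1 / t ^ n" if t: "norm a < t" "t < 1" for t
  proof (rule maximum_modulus_frontier[of \<psi> "ball 0 t"])
    have t0: "0 < t" using t norm_ge_zero[of a] by linarith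
    show "\<psi> holomorphic_on interior (ball 0 t)"
      using hol t by (auto intro: holomorphic_on_subset)
    show "continuous_on (closure (ball 0 t)) \<psi>"
      using t t0 by (intro holomorphic_on_imp_continuous_on holomorphic_on_subset[OF hol]) auto
    show "norm (\<psi> z) \<le> 1 / t ^ n" if "z \<in> frontier (ball 0 t)" for z
      using that no[of z] t t0 by (auto simp: norm_mult norm_power field_simps)
  qed (use t in auto)
  have "eventually (\<lambda>t. norm (\<psi> a) \<le> 1 / t ^ n) (at_left 1)"
    unfolding eventually_at_left_field using le a by (intro exI[of _ "norm a"]) auto
  moreover have "((\<lambda>t::real. 1 / t ^ n) \<longlongrightarrow> 1 / 1 ^ n) (at_left 1)"
    by (intro tendsto_intros) auto
  ultimately show ?thesis
    using tendsto_lowerbound[of "\<lambda>t. 1 / t ^ n" 1 "at_left 1" "norm (\<psi> a)"] by simp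
qed

text \<open>The sum is the quotient of \<open>t * (1 - t ^ (2 * n))\<close> by 1 - t^2, which
  appears when Schwarz-Pick for the cofactor of z^n is compared with the desired bound for the
  product.\<close>

lemma odd_power_sum_le:
  fixes t s :: real
  assumes t: "0 \<le> t" "t \<le> 1" and s: "0 \<le> s" "s \<le> 1"
  shows "(1 + s) * (\<Sum>k<n. t ^ (2 * k + 1)) \<le> real n * (1 + t ^ (2 * n) * s)"
proof -
  define A where "A = (\<Sum>k<n. t ^ (2 * k + 1))"
  have A1: "A \<le> real n"
  proof -
    have "A \<le> (\<Sum>k<n. 1)" unfolding A_def using t by (intro sum_mono power_le_one) auto
    then show ?thesis by simp
  qed
  \<comment> \<open>Pair the exponents \<open>j\<close> and \<open>2n - j\<close>: \<open>(1 - t^j)(1 - t^(2n-j)) \<ge> 0\<close>.\<close>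
  have "2 * A = (\<Sum>k<n. t ^ (2 * k + 1) + t ^ (2 * (n - Suc k) + 1))"
    using sum.nat_diff_reindex[of "\<lambda>k. t ^ (2 * k + 1)" n] by (simp only: sum.distrib A_def)
  also have "\<dots> \<le> (\<Sum>k<n. 1 + t ^ (2 * n))"
  proof (rule sum_mono)
    fix k assume k: "k \<in> {..<n}"
    define x y where "x = t ^ (2 * k + 1)" and "y = t ^ (2 * (n - Suc k) + 1)"
    have "x * y = t ^ (2 * n)"
      unfolding x_def y_def power_add[symmetric] using k by (intro arg_cong[of _ _ "power t"]) auto
    moreover have "0 \<le> (1 - x) * (1 - y)"
      unfolding x_def y_def using t by (intro mult_nonneg_nonneg) (auto intro!: power_le_one simp del: power_Suc)
    ultimately show "x + y \<le> 1 + t ^ (2 * n)" by (simp add: algebra_simps)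
  qed
  finally have A2: "2 * A \<le> real n * (1 + t ^ (2 * n))" by simp
  \<comment> \<open>Both sides of the claim are affine in \<open>s\<close>, so it is a convex
    combination of the cases s = 0, given by \<open>A1\<close>, and s = 1, given by
    \<open>A2\<close>.\<close>
  have "(1 + s) * A = (1 - s) * A + s * (2 * A)" by (simp add: algebra_simps)
  also have "\<dots> \<le> (1 - s) * real n + s * (real n * (1 + t ^ (2 * n)))"
    using s A1 A2 by (intro add_mono mult_left_mono) auto
  finally show ?thesis by (simp add: A_def algebra_simps)
qed

text \<open>Schwarz-Pick is applied to the cofactor \<psi> rather than to the product, which would
  lose the power \<open>norm z ^ n\<close> for n > 1. What remains is a real inequality in t = |z|
  and s = |\<psi> z|. Equality holds for \<psi> = 1.\<close>

lemma Schwarz_Pick_power_deriv: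
  fixes \<psi> :: "complex \<Rightarrow> complex"
  assumes n: "n \<ge> 1" and hol: "\<psi> holomorphic_on ball 0 1"
    and no: "\<And>z. norm z < 1 \<Longrightarrow> norm (z ^ n * \<psi> z) \<le> 1" and z: "norm z < 1"
  shows "(1 - norm z ^ (2 * n)) * norm (z * deriv (\<lambda>z. z ^ n * \<psi> z) z)
     \<le> real n * norm z ^ n * (1 - (norm (z ^ n * \<psi> z))\<^sup>2)"
proof -
  define t s where "t = norm z" and "s = norm (\<psi> z)"
  define S where "S = (\<Sum>k<n. t ^ (2 * k + 1))"
  have bd: "norm (\<psi> w) \<le> 1" if "norm w < 1" for w
    using norm_le_1_of_power_mult[OF hol no that] by simp
  have ts: "0 \<le> t" "t < 1" "0 \<le> s" "s \<le> 1" using bd z by (auto simp: t_def s_def)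
  have "((\<lambda>z. z ^ n * \<psi> z) has_field_derivative
      of_nat n * z ^ (n - 1) * \<psi> z + z ^ n * deriv \<psi> z) (at z)"
    using holomorphic_derivI[OF hol, of z] z by (auto intro!: derivative_eq_intros)
  then have "z * deriv (\<lambda>z. z ^ n * \<psi> z) z = z ^ n * (of_nat n * \<psi> z + z * deriv \<psi> z)"
    using n by (cases n) (auto simp: DERIV_imp_deriv algebra_simps)
  then have "norm (z * deriv (\<lambda>z. z ^ n * \<psi> z) z) = t ^ n * norm (of_nat n * \<psi> z + z * deriv \<psi> z)"
    by (simp add: norm_mult norm_power t_def)
  also have "norm (of_nat n * \<psi> z + z * deriv \<psi> z) \<le> real n * s + t * norm (deriv \<psi> z)"
    by (rule order.trans[OF norm_triangle_ineq]) (simp add: norm_mult t_def s_def)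
  finally have le: "norm (z * deriv (\<lambda>z. z ^ n * \<psi> z) z) \<le> t ^ n * (real n * s + t * norm (deriv \<psi> z))"
    using ts by (simp add: mult_left_mono)
  \<comment> \<open>This trades the factor 1 - t^(2n) of the claim for the factor 1 - t^2 that
    Schwarz-Pick for \<psi> provides.\<close>
  have geo: "(1 - t ^ (2 * n)) * t = (1 - t\<^sup>2) * S"
  proof -
    have "1 - t ^ (2 * n) = (1 - t\<^sup>2) * (\<Sum>k<n. t ^ (2 * k))"
      using one_diff_power_eq[of "t\<^sup>2" n] by (simp only: power_mult)
    moreover have "S = (\<Sum>k<n. t ^ (2 * k)) * t"
      by (simp add: S_def sum_distrib_left mult.commute)
    ultimately show ?thesis by simp
  qed
  have tn: "t ^ (2 * n) \<le> 1" using ts by (intro power_le_one) auto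
  have S0: "S \<ge> 0" using ts by (auto simp: S_def intro!: sum_nonneg)
  have SP: "(1 - t\<^sup>2) * norm (deriv \<psi> z) \<le> 1 - s\<^sup>2"
    unfolding t_def s_def by (rule Schwarz_Pick_deriv[OF hol bd z])
  have "(1 - t ^ (2 * n)) * norm (z * deriv (\<lambda>z. z ^ n * \<psi> z) z)
      \<le> (1 - t ^ (2 * n)) * (t ^ n * (real n * s + t * norm (deriv \<psi> z)))"
    using le tn by (intro mult_left_mono) auto
  also have "\<dots> = t ^ n * ((1 - t ^ (2 * n)) * real n * s + (1 - t ^ (2 * n)) * t * norm (deriv \<psi> z))"
    by (simp add: algebra_simps)
  also have "(1 - t ^ (2 * n)) * t * norm (deriv \<psi> z) = S * ((1 - t\<^sup>2) * norm (deriv \<psi> z))"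
    by (simp add: geo)
  also have "t ^ n * ((1 - t ^ (2 * n)) * real n * s + S * ((1 - t\<^sup>2) * norm (deriv \<psi> z)))
      \<le> t ^ n * ((1 - t ^ (2 * n)) * real n * s + S * (1 - s\<^sup>2))"
    using SP S0 ts by (intro mult_left_mono add_left_mono) auto
  \<comment> \<open>With the nonnegative factor 1 - s split off, \<open>odd_power_sum_le\<close>
    applies, and the terms linear in s then cancel.\<close>
  also have "S * (1 - s\<^sup>2) = (1 - s) * ((1 + s) * S)" by (simp add: algebra_simps power2_eq_square)
  also have "t ^ n * ((1 - t ^ (2 * n)) * real n * s + (1 - s) * ((1 + s) * S))
      \<le> t ^ n * ((1 - t ^ (2 * n)) * real n * s + (1 - s) * (real n * (1 + t ^ (2 * n) * s)))"
    using ts odd_power_sum_le[of t s n]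
    by (intro mult_left_mono add_left_mono) (auto simp: S_def)
  also have "\<dots> = real n * t ^ n * (1 - t ^ (2 * n) * s\<^sup>2)"
    by (simp add: algebra_simps power2_eq_square)
  also have "t ^ (2 * n) * s\<^sup>2 = (norm (z ^ n * \<psi> z))\<^sup>2"
    by (simp add: norm_mult norm_power t_def s_def power_mult_distrib power_mult mult.commute flip: power_mult)
  finally show ?thesis by (simp add: t_def)
qed

section \<open>The class P_n and its logarithmic derivative\<close>

lemma class_P_factor:
  assumes "p \<in> class_P n" "n \<ge> 1"
  obtains q where "q holomorphic_on ball 0 1" "\<And>z. norm z < 1 \<Longrightarrow> p z = 1 + z ^ n * q z"
proof -
  obtain c where c: "c 0 = 1" "\<And>k. 1 \<le> k \<and> k < n \<Longrightarrow> c k = 0"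
    "\<And>z. norm z < 1 \<Longrightarrow> (\<lambda>k. c k * z ^ k) sums p z"
    using assms unfolding class_P_def unit_disk_def by auto
  \<comment> \<open>\<open>c n\<close> is the removable value at the origin, so the shifted series
    sums to \<open>q\<close> on the whole disk.\<close>
  define q where "q z = (if z = 0 then c n else (p z - 1) / z ^ n)" for z
  have "(\<lambda>k. c (k + n) * z ^ k) sums q z" if z: "norm z < 1" for z
  proof (cases "z = 0")
    case True
    then show ?thesis using powser_sums_zero[of "\<lambda>k. c (k + n)"] by (simp add: q_def)
  next
    case False
    have "(\<Sum>k<n. c k * z ^ k) = (\<Sum>k\<in>{0}. c k * z ^ k)"
      using c(2) assms(2) by (intro sum.mono_neutral_right) (auto simp: Suc_le_eq)
    then have "(\<lambda>k. c (k + n) * z ^ (k + n)) sums (p z - 1)"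
      using c(3)[OF z] c(1) sums_iff_shift[of "\<lambda>k. c k * z ^ k" n "p z - 1"] by simp
    then have "(\<lambda>k. c (k + n) * z ^ (k + n) / z ^ n) sums ((p z - 1) / z ^ n)"
      by (rule sums_divide)
    then show ?thesis using False by (simp add: q_def power_add)
  qed
  then have "q holomorphic_on ball 0 1"
    by (intro power_series_holomorphic[where a = "\<lambda>k. c (k + n)"]) auto
  moreover have "p z = 1 + z ^ n * q z" if z: "norm z < 1" for z
    using c(3)[of 0] c(1) powser_sums_zero[of c] assms(2) sums_unique2 by (auto simp: q_def)
  ultimately show ?thesis using that by blast
qed

text \<open>A converse of \<open>class_P_factor\<close>: the coefficients are those of
  \<open>q\<close> shifted by n. It admits the extremal function without writing out its
  series.\<close>

lemma class_P_I:
  assumes n: "n \<ge> 1" and q: "q holomorphic_on ball 0 1"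
    and p: "\<And>z. norm z < 1 \<Longrightarrow> p z = 1 + z ^ n * q z" and pos: "\<And>z. norm z < 1 \<Longrightarrow> Re (p z) > 0"
  shows "p \<in> class_P n"
proof -
  define d where "d k = (deriv ^^ k) q 0 / fact k" for k
  define c where "c k = (if k = 0 then 1 else if k < n then 0 else d (k - n))" for k
  have sums: "(\<lambda>k. c k * z ^ k) sums p z" if z: "norm z < 1" for z
  proof -
    have "(\<lambda>k. d k * z ^ k) sums q z"
      using holomorphic_power_series[OF q, of z] z by (simp add: d_def)
    then have "(\<lambda>k. z ^ n * (d k * z ^ k)) sums (z ^ n * q z)"
      by (rule sums_mult)
    moreover have "c (k + n) * z ^ (k + n) = z ^ n * (d k * z ^ k)" for k
      using n by (simp add: c_def power_add)
    ultimately have "(\<lambda>k. c (k + n) * z ^ (k + n)) sums (z ^ n * q z)" by simp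
    moreover have "(\<Sum>k<n. c k * z ^ k) = (\<Sum>k\<in>{0}. c k * z ^ k)"
      using n by (intro sum.mono_neutral_right) (auto simp: c_def)
    ultimately show ?thesis
      using sums_iff_shift[of "\<lambda>k. c k * z ^ k" n "z ^ n * q z"] by (simp add: p[OF z] c_def add.commute)
  qed
  have "p holomorphic_on ball 0 1"
    using sums by (intro power_series_holomorphic[where a = c]) auto
  moreover have "c 0 = 1 \<and> (\<forall>k. 1 \<le> k \<and> k < n \<longrightarrow> c k = 0)" by (simp add: c_def)
  ultimately show ?thesis using sums pos unfolding class_P_def unit_disk_def by auto
qed

text \<open>The Cayley transform \<phi> = (1 - p)/(1 + p) maps into the disk and vanishes to order
  at least n at 0. In terms of it, z p'/p = -2 z \<phi>'/(1 - \<phi>^2), and |1 - \<phi>^2| \<ge> 1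
  - |\<phi>|^2 cancels the corresponding factor in the Schwarz-Pick bound.\<close>

lemma class_P_log_deriv_bound:
  assumes p: "p \<in> class_P n" and n: "n \<ge> 1" and z: "norm z < 1"
  shows "norm (z * deriv p z / p z) \<le> 2 * real n * norm z ^ n / (1 - norm z ^ (2 * n))"
proof -
  obtain q where q: "q holomorphic_on ball 0 1" "\<And>z. norm z < 1 \<Longrightarrow> p z = 1 + z ^ n * q z"
    using class_P_factor[OF p n] by blast
  have holp: "p holomorphic_on ball 0 1" and pos: "\<And>z. norm z < 1 \<Longrightarrow> Re (p z) > 0"
    using p by (auto simp: class_P_def unit_disk_def)
  have p1: "1 + p w \<noteq> 0" and p0: "p w \<noteq> 0" if "norm w < 1" for w
    using pos[OF that] by (auto simp: complex_eq_iff)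
  \<comment> \<open>Since 1 - p = - z^n q, this is the Cayley transform with z^n divided out, free
    of a singularity at 0.\<close>
  define \<psi> where "\<psi> w = - q w / (1 + p w)" for w
  define \<phi> where "\<phi> w = w ^ n * \<psi> w" for w
  have hol\<psi>: "\<psi> holomorphic_on ball 0 1"
    unfolding \<psi>_def using p1 by (intro holomorphic_intros q(1) holp) auto
  have \<phi>: "\<phi> w = (1 - p w) / (1 + p w)" if "norm w < 1" for w
    using q(2)[OF that] by (simp add: \<phi>_def \<psi>_def)
  have no: "norm (\<phi> w) < 1" if "norm w < 1" for w
  proof -
    have "(norm (1 - p w))\<^sup>2 < (norm (1 + p w))\<^sup>2"
      unfolding cmod_power2 using pos[OF that] by (simp add: power2_eq_square algebra_simps)
    then have "norm (1 - p w) < norm (1 + p w)" by (rule power2_less_imp_less) simp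
    then show ?thesis using p1[OF that] by (simp add: \<phi>[OF that] norm_divide)
  qed
  have "((\<lambda>w. (1 - p w) / (1 + p w)) has_field_derivative - 2 * deriv p z / (1 + p z)\<^sup>2) (at z)"
    using holomorphic_derivI[OF holp, of z] z p1[OF z]
    by (auto intro!: derivative_eq_intros simp: field_simps power2_eq_square)
  then have "(\<phi> has_field_derivative - 2 * deriv p z / (1 + p z)\<^sup>2) (at z)"
    by (rule has_field_derivative_transform_within_open[of _ _ _ "ball 0 1"]) (use z \<phi> in auto)
  then have d\<phi>: "deriv \<phi> z = - 2 * deriv p z / (1 + p z)\<^sup>2" by (rule DERIV_imp_deriv)
  have "1 - (\<phi> z)\<^sup>2 = 4 * p z / (1 + p z)\<^sup>2"
  proof -
    have "1 - (\<phi> z)\<^sup>2 = ((1 + p z)\<^sup>2 - (1 - p z)\<^sup>2) / (1 + p z)\<^sup>2"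
      using p1[OF z] unfolding \<phi>[OF z] by (simp add: diff_divide_distrib[of "(1 + p z)\<^sup>2"] power_divide)
    then show ?thesis by (simp add: power2_eq_square algebra_simps)
  qed
  then have eq: "z * deriv p z / p z = - 2 * (z * deriv \<phi> z) / (1 - (\<phi> z)\<^sup>2)"
    using p1[OF z] p0[OF z] by (simp add: d\<phi>)
  have r1: "(norm (\<phi> z))\<^sup>2 < 1" using no[OF z] by (simp add: power_less_one_iff)
  have le1: "1 - (norm (\<phi> z))\<^sup>2 \<le> norm (1 - (\<phi> z)\<^sup>2)"
    using norm_triangle_ineq2[of 1 "(\<phi> z)\<^sup>2"] by (simp add: norm_power)
  have "norm (z ^ n * \<psi> z) \<le> 1" if "norm z < 1" for z
    using no[OF that] by (simp add: \<phi>_def)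
  then have SP: "(1 - norm z ^ (2 * n)) * norm (z * deriv \<phi> z) \<le> real n * norm z ^ n * (1 - (norm (\<phi> z))\<^sup>2)"
    unfolding \<phi>_def using Schwarz_Pick_power_deriv[OF n hol\<psi> _ z] by simp
  have tn: "norm z ^ (2 * n) < 1" using z n by (simp add: power_less_one_iff)
  have "norm (z * deriv p z / p z) = 2 * norm (z * deriv \<phi> z) / norm (1 - (\<phi> z)\<^sup>2)"
    unfolding eq by (simp add: norm_mult norm_divide)
  also have "\<dots> \<le> 2 * norm (z * deriv \<phi> z) / (1 - (norm (\<phi> z))\<^sup>2)"
    using le1 r1 by (intro divide_left_mono mult_pos_pos) auto
  also have "\<dots> \<le> 2 * real n * norm z ^ n / (1 - norm z ^ (2 * n))"
    using SP r1 tn by (simp add: field_simps)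
  finally show ?thesis .
qed

section \<open>Scaling and factorization in the classes A_n and F_n\<close>

lemma class_A_antimono:
  assumes "m \<le> n" shows "class_A n \<subseteq> class_A m"
proof
  fix f assume "f \<in> class_A n"
  then obtain b :: "nat \<Rightarrow> complex" where "f holomorphic_on unit_disk" "b 0 = 0" "b 1 = 1"
    "\<forall>k. 2 \<le> k \<and> k \<le> n \<longrightarrow> b k = 0" "\<forall>z\<in>unit_disk. (\<lambda>k. b k * z ^ k) sums f z"
    unfolding class_A_def by blast
  then show "f \<in> class_A m" unfolding class_A_def using assms by (auto intro!: exI[of _ b])
qed

lemma class_A_scale:
  assumes "f \<in> class_A n" "0 < r" "r \<le> 1"
  shows "(\<lambda>z. f (of_real r * z) / of_real r) \<in> class_A n"
proof -
  obtain b where b: "b 0 = 0" "b 1 = 1" "\<And>k. 2 \<le> k \<and> k \<le> n \<Longrightarrow> b k = 0"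
    "\<And>z. norm z < 1 \<Longrightarrow> (\<lambda>k. b k * z ^ k) sums f z"
    using assms(1) unfolding class_A_def unit_disk_def by auto
  define a where "a k = b k * of_real r ^ k / of_real r" for k
  have sums: "(\<lambda>k. a k * z ^ k) sums (f (of_real r * z) / of_real r)" if z: "norm z < 1" for z
  proof -
    have "norm (of_real r * z) < 1"
      using z assms(2,3) mult_mono[of r 1 "norm z" "norm z"] by (simp add: norm_mult)
    from sums_divide[OF b(4)[OF this], of "of_real r"] show ?thesis
      by (simp add: a_def power_mult_distrib mult_ac)
  qed
  have "(\<lambda>z. f (of_real r * z) / of_real r) holomorphic_on ball 0 1"
    using sums by (intro power_series_holomorphic[where a = a]) auto
  moreover have "a 0 = 0" "a 1 = 1" "\<And>k. 2 \<le> k \<and> k \<le> n \<Longrightarrow> a k = 0"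
    using b(1-3) assms(2) by (auto simp: a_def)
  ultimately show ?thesis
    using sums unfolding class_A_def unit_disk_def by (auto intro!: exI[of _ a])
qed

lemma class_F_I:
  assumes p: "p \<in> class_P n"
  shows "(\<lambda>z. z * p z) \<in> class_F n"
proof -
  obtain c where c: "c 0 = 1" "\<And>k. 1 \<le> k \<and> k < n \<Longrightarrow> c k = 0"
    "\<And>z. norm z < 1 \<Longrightarrow> (\<lambda>k. c k * z ^ k) sums p z"
    and hol: "p holomorphic_on ball 0 1"
    using p unfolding class_P_def unit_disk_def by auto
  \<comment> \<open>Multiplication by z shifts the indices by one: the gap 1 \<le> k < n for
    \<open>c\<close> becomes 2 \<le> k \<le> n for \<open>b\<close>.\<close>
  define b where "b k = (case k of 0 \<Rightarrow> 0 | Suc j \<Rightarrow> c j)" for k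
  have "(\<lambda>k. b k * z ^ k) sums (z * p z)" if z: "norm z < 1" for z
  proof -
    have "(\<lambda>k. b (Suc k) * z ^ Suc k) sums (z * p z)"
      using sums_mult[OF c(3)[OF z], of z] by (simp add: b_def mult_ac)
    then show ?thesis by (subst (asm) sums_Suc_iff) (simp add: b_def)
  qed
  moreover have "b 0 = 0" "b 1 = 1" "\<And>k. 2 \<le> k \<and> k \<le> n \<Longrightarrow> b k = 0"
    using c(1,2) by (auto simp: b_def split: nat.splits)
  moreover have "(\<lambda>z. z * p z) holomorphic_on ball 0 1" by (intro holomorphic_intros hol)
  ultimately have "(\<lambda>z. z * p z) \<in> class_A n"
    unfolding class_A_def unit_disk_def by (auto intro!: exI[of _ b])
  moreover have "p 0 = 1"
    using c(3)[of 0] c(1) powser_sums_zero[of c] sums_unique2 by fastforce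
  then have "(\<lambda>z. if z = 0 then 1 else z * p z / z) = p" by auto
  ultimately show ?thesis using p by (simp add: class_F_def)
qed

lemma class_F_factor:
  assumes "f \<in> class_F n"
  obtains p where "p \<in> class_P n" "\<And>z. norm z < 1 \<Longrightarrow> f z = z * p z"
proof
  let ?p = "\<lambda>z. if z = 0 then 1 else f z / z"
  show "?p \<in> class_P n" using assms by (simp add: class_F_def)
  \<comment> \<open>The quotient has the value 1 at the origin by convention, so there the
    factorization amounts to \<open>f 0 = 0\<close>.\<close>
  obtain b :: "nat \<Rightarrow> complex" where "b 0 = 0" "\<And>z. norm z < 1 \<Longrightarrow> (\<lambda>k. b k * z ^ k) sums f z"
    using assms unfolding class_F_def class_A_def unit_disk_def by auto
  then have "(\<lambda>k. b k * 0 ^ k) sums f 0" "(\<lambda>k. b k * 0 ^ k) sums 0"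
    using powser_sums_zero[of b] by (metis norm_zero zero_less_one, metis)
  then have "f 0 = 0" by (rule sums_unique2)
  then show "f z = z * ?p z" for z by auto
qed

text \<open>Logarithmic differentiation of w p(w) at w = r z: the factor w contributes 1, and the
  scaling constants cancel. The convention at z = 0 agrees with the formula.\<close>

lemma zf'_over_f_scale:
  assumes p: "p holomorphic_on ball 0 1" and p0: "\<And>z. norm z < 1 \<Longrightarrow> p z \<noteq> 0"
    and f: "\<And>z. norm z < 1 \<Longrightarrow> f z = z * p z" and r: "0 < r" "norm (of_real r * z) < 1"
  shows "zf'_over_f (\<lambda>z. f (of_real r * z) / of_real r) z
    = 1 + of_real r * z * deriv p (of_real r * z) / p (of_real r * z)"
proof (cases "z = 0")
  case False
  define w where "w = of_real r * z"
  have w: "norm w < 1" using r by (simp add: w_def)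
  have "((\<lambda>w. w * p w) has_field_derivative p w + w * deriv p w) (at w)"
    using holomorphic_derivI[OF p, of w] w by (auto intro!: derivative_eq_intros)
  then have "(f has_field_derivative p w + w * deriv p w) (at w)"
    by (rule has_field_derivative_transform_within_open[of _ _ _ "ball 0 1"]) (use w f in auto)
  then have "(f has_field_derivative p w + w * deriv p w) (at (of_real r * z))" by (simp add: w_def)
  moreover have "((\<lambda>z. of_real r * z) has_field_derivative of_real r) (at z)"
    by (auto intro!: derivative_eq_intros)
  ultimately have "((\<lambda>z. f (of_real r * z)) has_field_derivative (p w + w * deriv p w) * of_real r) (at z)"
    by (rule DERIV_chain2)
  from DERIV_cdivide[OF this, of "of_real r"]
  have "((\<lambda>z. f (of_real r * z) / of_real r) has_field_derivative (p w + w * deriv p w)) (at z)"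
    using r(1) by simp
  then have "deriv (\<lambda>z. f (of_real r * z) / of_real r) z = p w + w * deriv p w"
    by (rule DERIV_imp_deriv)
  then have "zf'_over_f (\<lambda>z. f (of_real r * z) / of_real r) z = z * (p w + w * deriv p w) / (w * p w / of_real r)"
    using False f[OF w] by (simp add: zf'_over_f_def w_def)
  also have "\<dots> = 1 + w * deriv p w / p w"
    using False p0[OF w] r(1) by (simp add: w_def divide_simps)
  finally show ?thesis by (simp add: w_def)
qed (simp add: zf'_over_f_def)

section \<open>The radius and its sharpness\<close>

theorem class_F_radius:
  assumes n: "n \<ge> 1"
  shows "is_radius (S_wp_n n) (class_F n)
     (root n (sqrt (1 + (real n)^2 * (exp 1)^2) - real n * exp 1))"
proof -
  define \<rho> where "\<rho> = sqrt (1 + (real n)^2 * (exp 1)^2) - real n * exp 1"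
  define R where "R = root n \<rho>"
  have \<rho>0: "0 < \<rho>"
  proof -
    have "real n * exp 1 = sqrt ((real n)^2 * (exp 1)^2)" by (simp add: real_sqrt_mult)
    also have "\<dots> < sqrt (1 + (real n)^2 * (exp 1)^2)" by simp
    finally show ?thesis by (simp add: \<rho>_def)
  qed
  \<comment> \<open>\<rho> is the positive root of t^2 + 2 n e t = 1, which is 2 n t/(1 - t^2) = 1/e
    cleared of denominators.\<close>
  have \<rho>eq: "\<rho>\<^sup>2 + 2 * real n * exp 1 * \<rho> = 1"
  proof -
    have "(\<rho> + real n * exp 1)\<^sup>2 = 1 + (real n)^2 * (exp 1)^2"
      by (simp add: \<rho>_def add_nonneg_nonneg)
    then show ?thesis by (simp add: power2_eq_square algebra_simps)
  qed
  have \<rho>sq: "\<rho>\<^sup>2 < 1" using \<rho>eq \<rho>0 n by (smt (verit) exp_gt_zero mult_pos_pos of_nat_0_less_iff less_le_trans zero_less_one of_nat_1 of_nat_le_iff)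
  then have \<rho>1: "\<rho> < 1" using \<rho>0 by (simp add: power_less_one_iff)
  have R0: "0 < R" and R1: "R < 1" and Rn: "R ^ n = \<rho>"
    using \<rho>0 \<rho>1 n by (auto simp: R_def)
  have "radius_good (S_wp_n n) (class_F n) R"
    unfolding radius_good_def
  proof (intro allI impI ballI)
    fix r f assume r: "0 < r \<and> r \<le> R" and f: "f \<in> class_F n"
    let ?g = "\<lambda>z. f (of_real r * z) / of_real r"
    obtain p where p: "p \<in> class_P n" "\<And>z. norm z < 1 \<Longrightarrow> f z = z * p z"
      using class_F_factor[OF f] by blast
    have holp: "p holomorphic_on ball 0 1" and p0: "\<And>z. norm z < 1 \<Longrightarrow> p z \<noteq> 0"
      using p(1) by (force simp: class_P_def unit_disk_def)+
    define h where "h z = z * deriv p z / p z" for z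
    have holh: "h holomorphic_on ball 0 1"
      unfolding h_def using p0 by (intro holomorphic_intros holp) auto
    have h: "norm (h z) < 1 / exp 1" if z: "norm z < R" for z
    proof -
      define t where "t = norm z ^ n"
      have t: "0 \<le> t" "t < \<rho>" using z n power_strict_mono[of "norm z" R n] by (auto simp: t_def Rn)
      have "t\<^sup>2 < \<rho>\<^sup>2" using t by (intro power_strict_mono) auto
      moreover have "2 * real n * exp 1 * t \<le> 2 * real n * exp 1 * \<rho>" using t by (intro mult_left_mono) auto
      ultimately have "2 * real n * exp 1 * t < 1 - t\<^sup>2" "t\<^sup>2 < 1" using \<rho>eq \<rho>sq by linarith+
      then have "2 * real n * t / (1 - t\<^sup>2) < 1 / exp 1" by (simp add: field_simps)
      moreover have "norm (h z) \<le> 2 * real n * t / (1 - t\<^sup>2)"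
        unfolding h_def t_def using class_P_log_deriv_bound[OF p(1) n, of z] z R1
        by (simp add: power_mult mult.commute flip: power_mult)
      ultimately show ?thesis by linarith
    qed
    \<comment> \<open>The bound on \<open>h\<close> holds on the open disk of radius
      \<open>R\<close>. As |z| < 1, the point r z stays strictly inside even when r = R, so the
      radius itself is admissible.\<close>
    have small: "norm (of_real r * z) < R" if "norm z < 1" for z :: complex
      using r that mult_le_less_imp_less[of r R "norm z" 1] by (simp add: norm_mult)
    obtain W where W: "W holomorphic_on ball 0 (1 / exp 1)" "W ` ball 0 (1 / exp 1) \<subseteq> ball 0 1"
      "\<And>w. w \<in> ball 0 (1 / exp 1) \<Longrightarrow> W w * exp (W w) = w" "W 0 = 0"
      using Lambert_W_exists by blast
    define \<omega> where "\<omega> z = W (h (of_real r * z))" for z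
    have hin: "h (of_real r * z) \<in> ball 0 (1 / exp 1)" if "norm z < 1" for z
      using h[OF small[OF that]] by simp
    have "(\<lambda>z. h (of_real r * z)) holomorphic_on ball 0 1"
    proof -
      have "(h \<circ> (\<lambda>z. of_real r * z)) holomorphic_on ball 0 1"
        using small R1 by (intro holomorphic_on_compose_gen[OF _ holh] holomorphic_intros) force
      then show ?thesis by (simp add: o_def)
    qed
    then have "(W \<circ> (\<lambda>z. h (of_real r * z))) holomorphic_on ball 0 1"
      using hin by (intro holomorphic_on_compose_gen[OF _ W(1)]) auto
    then have "\<omega> holomorphic_on ball 0 1" by (simp add: o_def \<omega>_def[abs_def])
    moreover have "\<omega> ` ball 0 1 \<subseteq> ball 0 1" using W(2) hin by (fastforce simp: \<omega>_def)
    moreover have "\<omega> 0 = 0" by (simp add: \<omega>_def h_def W(4))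
    moreover have "zf'_over_f ?g z = wp (\<omega> z)" if z: "norm z < 1" for z
    proof -
      have "norm (of_real r * z) < 1" using small[OF z] R1 by linarith
      then have "zf'_over_f ?g z = 1 + h (of_real r * z)"
        unfolding h_def using zf'_over_f_scale[OF holp p0 p(2)] r by blast
      then show ?thesis using W(3)[OF hin[OF z]] by (simp add: wp_def \<omega>_def)
    qed
    ultimately have "subordinate (zf'_over_f ?g) wp"
      unfolding subordinate_def unit_disk_def by (intro exI[of _ \<omega>]) auto
    moreover have "?g \<in> class_A n"
      using f r R1 by (intro class_A_scale) (auto simp: class_F_def)
    ultimately show "?g \<in> S_wp_n n"
      using class_A_antimono[OF n] by (auto simp: S_wp_n_def S_wp_def)
  qed
  moreover have "r0 \<le> R" if r0: "r0 \<in> {0<..1}" and good: "radius_good (S_wp_n n) (class_F n) r0" for r0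
  proof (rule ccontr)
    assume "\<not> r0 \<le> R"
    then have lt: "R < r0" by simp
    \<comment> \<open>The extremal choice has Cayley transform z^n, that is \<psi> = 1; at positive
      real z every estimate in the bound for z p'/p becomes an equality.\<close>
    define p :: "complex \<Rightarrow> complex" where "p z = (1 - z ^ n) / (1 + z ^ n)" for z
    have zn: "norm (z ^ n) < 1" if "norm z < 1" for z :: complex
      using that n by (simp add: norm_power power_less_one_iff)
    have nz: "1 + z ^ n \<noteq> 0" "1 - z ^ n \<noteq> 0" if "norm z < 1" for z :: complex
      using zn[OF that] by (metis add_eq_0_iff norm_minus_cancel norm_one less_irrefl) 
        (use zn[OF that] in auto)
    have "p \<in> class_P n"
    proof (rule class_P_I[OF n, where q = "\<lambda>z. - 2 / (1 + z ^ n)"])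
      show "(\<lambda>z. - 2 / (1 + z ^ n)) holomorphic_on ball 0 1"
        using nz by (intro holomorphic_intros) auto
      fix z :: complex assume z: "norm z < 1"
      show "p z = 1 + z ^ n * (- 2 / (1 + z ^ n))" using nz[OF z] by (simp add: p_def field_simps)
      define u where "u = z ^ n"
      have "Re ((1 - u) / (1 + u)) = (1 - (norm u)\<^sup>2) / (norm (1 + u))\<^sup>2"
        unfolding Re_divide cmod_power2 by (simp add: power2_eq_square algebra_simps)
      moreover have "(norm u)\<^sup>2 < 1" using zn[OF z] by (simp add: u_def power_less_one_iff)
      ultimately show "Re (p z) > 0" using nz[OF z] by (simp add: p_def u_def)
    qed
    let ?f = "\<lambda>z. z * p z"
    let ?g = "\<lambda>z. ?f (of_real r0 * z) / of_real r0"
    have "?f \<in> class_F n" using \<open>p \<in> class_P n\<close> by (rule class_F_I)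
    then have "?g \<in> S_wp_n n"
      using good r0 unfolding radius_good_def by fastforce
    then obtain \<omega> where \<omega>: "\<omega> ` ball 0 1 \<subseteq> ball 0 1" "\<And>z. norm z < 1 \<Longrightarrow> zf'_over_f ?g z = wp (\<omega> z)"
      by (auto simp: S_wp_n_def S_wp_def subordinate_def unit_disk_def)
    \<comment> \<open>This point is scaled by \<open>r0\<close> to \<open>R\<close>, and it lies in
      the open disk exactly because R < r0.\<close>
    define z where "z = complex_of_real (R / r0)"
    have z: "norm z < 1" using lt R0 r0 by (simp add: z_def norm_divide)
    have rz: "of_real r0 * z = of_real R" using r0 by (simp add: z_def)
    have zR: "norm (complex_of_real R) < 1" using R0 R1 by simp
    have "(p has_field_derivative - 2 * of_nat n * of_real R ^ (n - 1) / (1 + of_real R ^ n)\<^sup>2) (at (of_real R))"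
      unfolding p_def using nz[OF zR]
      by (auto intro!: derivative_eq_intros simp: power2_eq_square algebra_simps)
    then have dp: "deriv p (of_real R) = - 2 * of_nat n * of_real R ^ (n - 1) / (1 + of_real R ^ n)\<^sup>2"
      by (rule DERIV_imp_deriv)
    have "of_real R * deriv p (of_real R) / p (of_real R)
        = - 2 * of_nat n * of_real R ^ n / ((1 + of_real R ^ n) * (1 - of_real R ^ n))"
      using nz[OF zR] n unfolding dp p_def by (cases n) (simp_all add: power2_eq_square)
    also have "\<dots> = of_real (- 2 * real n * \<rho> / (1 - \<rho>\<^sup>2))"
      by (simp add: Rn[symmetric] power2_eq_square algebra_simps)
    also have "- 2 * real n * \<rho> / (1 - \<rho>\<^sup>2) = - (1 / exp 1)"
    proof -
      have "1 - \<rho>\<^sup>2 = exp 1 * (2 * real n * \<rho>)" using \<rho>eq by (simp add: algebra_simps)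
      then show ?thesis using \<rho>0 n by simp
    qed
    finally have val: "of_real R * deriv p (of_real R) / p (of_real R) = - (1 / exp 1)"
      by (simp add: exp_of_real[symmetric])
    have "zf'_over_f ?g z = 1 + of_real r0 * z * deriv p (of_real r0 * z) / p (of_real r0 * z)"
    proof (rule zf'_over_f_scale)
      show "p holomorphic_on ball 0 1"
        using \<open>p \<in> class_P n\<close> by (simp add: class_P_def unit_disk_def)
    qed (use nz r0 rz zR in \<open>auto simp: p_def\<close>)
    then have "wp (\<omega> z) = 1 - 1 / exp 1" using \<omega>(2)[OF z] val by (simp add: rz)
    then have "\<omega> z * exp (\<omega> z) = - (1 / exp 1)" by (simp add: wp_def)
    moreover have "norm (\<omega> z) < 1" using \<omega>(1) z by (force simp: image_subset_iff)
    ultimately show False using mult_exp_neq_neg_inverse_exp by blast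
  qed
  ultimately show ?thesis
    using R0 R1 unfolding is_radius_def R_def \<rho>_def by auto
qed

theorem mainTheorem7:
  shows "(\<forall>n::nat. n \<ge> 1 \<longrightarrow>
           is_radius (S_wp_n n) (class_F n)
             (root n (sqrt (1 + (real n)^2 * (exp 1)^2) - real n * exp 1)))
         \<and> is_radius S_wp (class_F 1) (sqrt (1 + (exp 1)^2) - exp 1)"
proof -
  \<comment> \<open>Membership in \<open>class_A 1\<close> is already part of \<open>S_wp\<close>,
    so the second claim is the case n = 1.\<close>
  have "S_wp_n 1 = S_wp" by (auto simp: S_wp_n_def S_wp_def)
  then show ?thesis using class_F_radius class_F_radius[of 1] by simp
qed

end
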